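(* Let $I(n,k)$ be defined as in the context and let $J(n,k):=2^k(n+k-1)!\,I(n,k)$. Then for all $k\ge0$: $J(1,k)=1$, and $\sum_{k\ge0}J(1,k)x^k=\frac{1}{1-x}$; $J(2,k)=4^k-2^{k-1}$, and $\sum_{k\ge0}J(2,k)x^k=\frac{1/2}{(1-2x)(1-4x)}$; $J(3,k)=-\frac{25}{8}\,5^k+\frac34\,3^k+\frac{27}{8}\,9^k$, and $\sum_{k\ge0}J(3,k)x^k=\frac{1}{(1-3x)(1-5x)(1-9x)}$; $J(4,k)=\frac{64}{3}\,16^k+\frac{27}{2}\,6^k-\frac{250}{12}\,10^k-2\cdot4^k-8\cdot8^k$, and $\sum_{k\ge0}J(4,k)x^k=\frac{4-34x}{(1-4x)(1-6x)(1-8x)(1-10x)(1-16x)}$.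
   Context: The numbers $I(n,k)$ are defined recursively by: $I(n,k)=0$ if $k<0$ or $n<1$; $I(1,0)=1$; and for all $n\ge1$, $k\ge0$ with $(n,k)\neq(1,0)$, $$I(n,k)=\frac{1}{2(n+k-1)}\left(n^2 I(n,k-1)+\sum_{i=1}^{n-1}\sum_{j=0}^{k} i(n-i)\,I(i,j)\,I(n-i,k-j)\right).$$ (Combinatorially, $I(n,k)$ is the sum of the inverses of the orders of the automorphism groups of all pairwise non-isomorphic connected multigraphs, loops and multiple edges allowed, on $n$ vertices with cyclomatic number $k$.) *)

theory Defs
  imports Complex_Main "HOL-Computational_Algebra.Formal_Power_Series"
begin

function I :: "int \<Rightarrow> int \<Rightarrow> rat" where
  "I n k =
     (if k < 0 \<or> n < 1 then 0
      else if n = 1 \<and> k = 0 then 1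
      else 1 / (2 * of_int (n + k - 1)) *
        (of_int (n\<^sup>2) * I n (k - 1) +
         (\<Sum>i = 1..n - 1. \<Sum>j = 0..k. of_int (i * (n - i)) * I i j * I (n - i) (k - j))))"
  by auto
termination
  by (relation "measures [\<lambda>(n, k). nat n, \<lambda>(n, k). nat (k + 1)]") auto

declare I.simps [simp del]

(* The factorial uses truncated subtraction, which matters only for n = k = 0, where I 0 0 = 0. *)
definition J :: "nat \<Rightarrow> nat \<Rightarrow> rat" where
  "J n k = 2 ^ k * fact (n + k - 1) * I (int n) (int k)"

end

theory Submission imports Defs
begin

text \<open>
  Index the numbers by edges instead of cyclomatic number: the series
  \<open>G\<^sub>n(x) = \<Sum>\<^sub>m I(n, m - n + 1) x\<^sup>m\<close> turn the recursion into the differential equations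
  \<open>2 G\<^sub>n' = n\<^sup>2 G\<^sub>n + \<Sum>\<^sub>i i (n - i) G\<^sub>i G\<^sub>n\<^sub>-\<^sub>i\<close>, which determine \<open>G\<^sub>n\<close> from \<open>G\<^sub>1, \<dots>, G\<^sub>n\<^sub>-\<^sub>1\<close>
  and the constant term. The solutions are \<open>G\<^sub>1 = e\<close> with \<open>e = exp (x/2)\<close>, and polynomials in \<open>e\<close>
  for larger \<open>n\<close>, namely the coefficients of \<open>z\<^sup>n\<close> in \<open>log (\<Sum>\<^sub>n e\<^bsup>n\<^sup>2\<^esup> z\<^sup>n / n!)\<close>.
  Reading off coefficients gives \<open>J(n, k)\<close> as a combination of geometric sequences.
\<close>

unbundle fps_syntax

definition edge_gf :: "nat \<Rightarrow> rat fps" where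
  "edge_gf n = Abs_fps (\<lambda>m. I (int n) (int m - int n + 1))"

section \<open>From the recursion to differential equations\<close>

lemma I_neg: "k < 0 \<Longrightarrow> I n k = 0"
  by (simp add: I.simps)

lemma I_recursion:
  assumes "n \<ge> 1" "k \<ge> 0" "(n, k) \<noteq> (1, 0)"
  shows "2 * of_int (n + k - 1) * I n k = of_int (n\<^sup>2) * I n (k - 1) +
    (\<Sum>i = 1..n - 1. \<Sum>j = 0..k. of_int (i * (n - i)) * I i j * I (n - i) (k - j))"
    (is "2 * ?c * _ = ?R")
proof -
  have "?c \<noteq> 0"
    using assms by (subst of_int_eq_0_iff) auto
  moreover have "I n k = 1 / (2 * ?c) * ?R"
    using assms by (subst I.simps) (simp only: if_False not_less[symmetric] simp_thms prod.inject)
  moreover have "c \<noteq> 0 \<Longrightarrow> x = 1 / (2 * c) * r \<Longrightarrow> 2 * c * x = r" for c x r :: rat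
    by simp
  ultimately show ?thesis by blast
qed

text \<open>With \<open>a\<close> edges on \<open>i\<close> vertices the cyclomatic number is
  \<open>a - i + 1\<close>. Splitting \<open>m\<close> edges between two parts thus splits
  cyclomatic numbers with total \<open>m + 2 - (i + l)\<close>, which is the inner sum of the
  recursion.\<close>

lemma edge_gf_mult_nth:
  assumes "i \<ge> 1" "l \<ge> 1"
  shows "(edge_gf i * edge_gf l) $ m =
    (\<Sum>j = 0..int m + 2 - int (i + l). I (int i) j * I (int l) (int m + 2 - int (i + l) - j))"
    (is "_ = sum ?f {0..?k}")
proof -
  let ?h = "\<lambda>a. int a - int i + 1"
  have "(edge_gf i * edge_gf l) $ m = (\<Sum>a = 0..m. ?f (?h a))"
    by (auto simp: fps_mult_nth edge_gf_def intro!: sum.cong arg_cong2[where f = I])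
  also have "\<dots> = sum ?f (?h ` {0..m})"
    by (subst sum.reindex) (auto simp: inj_on_def)
  \<comment> \<open>Every index outside \<open>{0..?k}\<close> gives one factor a negative second
    argument, so its term vanishes.\<close>
  also have "\<dots> = sum ?f {0..?k}"
  proof (rule sum.mono_neutral_right)
    show "{0..?k} \<subseteq> ?h ` {0..m}"
    proof
      fix j assume "j \<in> {0..?k}"
      then have "j = ?h (nat (j + int i - 1))" "nat (j + int i - 1) \<in> {0..m}"
        using assms by auto
      then show "j \<in> ?h ` {0..m}" by blast
    qed
  qed (auto simp: I_neg)
  finally show ?thesis .
qed

text \<open>The factor \<open>n + k - 1\<close> of the recursion is the number of edges, so it comes
  from differentiation. At the coefficient of index \<open>m\<close> it equals \<open>m + 1\<close>;
  hence \<open>k = m + 2 - n\<close>, and the exceptional pair \<open>(1, 0)\<close> never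
  occurs.\<close>

lemma edge_gf_deriv:
  assumes "n \<ge> 1"
  shows "2 * fps_deriv (edge_gf n) = of_nat (n\<^sup>2) * edge_gf n +
    (\<Sum>i = 1..n - 1. of_nat (i * (n - i)) * (edge_gf i * edge_gf (n - i)))"
proof (rule fps_ext)
  fix m
  define k where "k = int m + 2 - int n"
  have conv: "(\<Sum>i = 1..n - 1. of_nat (i * (n - i)) * (edge_gf i * edge_gf (n - i))) $ m =
    (\<Sum>i = 1..int n - 1. \<Sum>j = 0..k. of_int (i * (int n - i)) * I i j * I (int n - i) (k - j))"
  proof -
    have "(\<Sum>i = 1..n - 1. of_nat (i * (n - i)) * (edge_gf i * edge_gf (n - i))) $ m =
      (\<Sum>i = 1..n - 1. of_nat (i * (n - i)) * (edge_gf i * edge_gf (n - i)) $ m)"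
      by (simp add: fps_sum_nth fps_of_nat[symmetric] del: of_nat_mult)
    also have "\<dots> = (\<Sum>i = 1..n - 1. \<Sum>j = 0..k.
        of_int (int i * (int n - int i)) * I (int i) j * I (int n - int i) (k - j))"
      by (intro sum.cong refl, subst edge_gf_mult_nth)
        (auto simp: k_def sum_distrib_left of_nat_diff mult.assoc)
    also have "\<dots> = (\<Sum>i = 1..int n - 1. \<Sum>j = 0..k.
        of_int (i * (int n - i)) * I i j * I (int n - i) (k - j))"
      by (rule sum.reindex_bij_witness[of _ nat int]) auto
    finally show ?thesis .
  qed
  have lhs: "(2 * fps_deriv (edge_gf n)) $ m = 2 * of_int (int n + k - 1) * I (int n) k"
    by (simp add: edge_gf_def k_def numeral_fps_const algebra_simps)
  have rhs: "(of_nat (n\<^sup>2) * edge_gf n) $ m = of_int ((int n)\<^sup>2) * I (int n) (k - 1)"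
    by (simp add: edge_gf_def k_def fps_of_nat[symmetric] algebra_simps del: of_nat_power)
  show "(2 * fps_deriv (edge_gf n)) $ m = (of_nat (n\<^sup>2) * edge_gf n +
    (\<Sum>i = 1..n - 1. of_nat (i * (n - i)) * (edge_gf i * edge_gf (n - i)))) $ m"
  proof (cases "k \<ge> 0")
    case True
    then have "(int n, k) \<noteq> (1, 0)" by (auto simp: k_def)
    with True show ?thesis
      using I_recursion[of "int n" k] assms unfolding fps_add_nth lhs rhs conv by simp
  next
    \<comment> \<open>For negative \<open>k\<close> all terms on both sides are zero.\<close>
    case False
    then show ?thesis
      unfolding fps_add_nth lhs rhs conv by (simp add: I_neg)
  qed
qed

section \<open>Solving the differential equations\<close>

text \<open>The difference of two solutions solves the homogeneous equation, so it is a multiple of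
  \<open>fps_exp (of_nat s / 2)\<close>; its constant term is zero.\<close>

lemma fps_linear_ODE_unique:
  fixes A B :: "'a :: field_char_0 fps"
  assumes "2 * fps_deriv A = of_nat s * A + H" "2 * fps_deriv B = of_nat s * B + H"
    and "A $ 0 = B $ 0"
  shows "A = B"
proof -
  have "2 * fps_deriv (A - B) = of_nat s * (A - B)"
    using assms(1,2) by (simp add: algebra_simps)
  then have "fps_const (1/2) * (2 * fps_deriv (A - B)) = fps_const (1/2) * (of_nat s * (A - B))"
    by simp
  then have "fps_deriv (A - B) = fps_const (of_nat s / 2) * (A - B)"
    by (simp add: numeral_fps_const fps_of_nat[symmetric] mult.assoc[symmetric])
  then have "A - B = fps_const ((A - B) $ 0) * fps_exp (of_nat s / 2)"
    using fps_exp_unique_ODE by blast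
  with assms(3) show ?thesis by simp
qed

abbreviation e :: "rat fps" where "e \<equiv> fps_exp (1/2)"

lemma e_power: "e ^ r = fps_exp (of_nat r / 2)"
  by (simp add: fps_exp_power_mult)

text \<open>Powers of \<open>e\<close> are eigenvectors of twice the derivative, so checking a
  proposed solution becomes polynomial arithmetic in \<open>e\<close>.\<close>

lemma deriv_e_power: "2 * fps_deriv (e ^ r) = of_nat r * e ^ r"
  unfolding e_power
  by (simp add: numeral_fps_const fps_of_nat[symmetric] mult.assoc[symmetric])

lemma e_power_nth: "(e ^ r) $ m = (of_nat r / 2) ^ m / fact m"
  by (simp add: e_power)

lemma edge_gf_0: "n \<ge> 2 \<Longrightarrow> edge_gf n $ 0 = 0"
  by (simp add: edge_gf_def I_neg)

lemma edge_gf_1: "edge_gf 1 = e"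
proof (rule fps_linear_ODE_unique)
  show "2 * fps_deriv (edge_gf 1) = of_nat 1 * edge_gf 1 + 0"
    using edge_gf_deriv[of 1] by simp
  show "2 * fps_deriv e = of_nat 1 * e + 0"
    using deriv_e_power[of 1] by simp
qed (simp add: edge_gf_def I.simps)

lemma edge_gf_2: "2 * edge_gf 2 = e ^ 4 - e ^ 2"
proof (rule fps_linear_ODE_unique)
  have "2 * fps_deriv (edge_gf 2) = 4 * edge_gf 2 + e ^ 2"
    using edge_gf_deriv[of 2] by (simp add: edge_gf_1[unfolded One_nat_def] power2_eq_square)
  then show "2 * fps_deriv (2 * edge_gf 2) = of_nat 4 * (2 * edge_gf 2) + 2 * e ^ 2"
    by (simp add: algebra_simps)
  show "2 * fps_deriv (e ^ 4 - e ^ 2) = of_nat 4 * (e ^ 4 - e ^ 2) + 2 * e ^ 2"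
    using deriv_e_power[of 4] deriv_e_power[of 2] by (simp add: algebra_simps)
qed (simp add: edge_gf_0 e_power_nth numeral_fps_const)

lemma edge_gf_3: "6 * edge_gf 3 = e ^ 9 - 3 * e ^ 5 + 2 * e ^ 3"
proof (rule fps_linear_ODE_unique)
  have set: "{Suc 0..2} = {1, 2}" by auto
  have "2 * fps_deriv (edge_gf 3) = 9 * edge_gf 3 + 4 * (edge_gf 1 * edge_gf 2)"
    using edge_gf_deriv[of 3] by (simp add: set algebra_simps)
  then have "2 * fps_deriv (edge_gf 3) = 9 * edge_gf 3 + 2 * e * (e ^ 4 - e ^ 2)"
    unfolding edge_gf_1 using edge_gf_2 by algebra
  then show "2 * fps_deriv (6 * edge_gf 3) = of_nat 9 * (6 * edge_gf 3) + 12 * (e ^ 5 - e ^ 3)"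
    by (simp add: algebra_simps) algebra
  have "2 * fps_deriv (e ^ 9 - 3 * e ^ 5 + 2 * e ^ 3) =
      2 * fps_deriv (e ^ 9) - 3 * (2 * fps_deriv (e ^ 5)) + 2 * (2 * fps_deriv (e ^ 3))"
    by (simp add: algebra_simps)
  then show "2 * fps_deriv (e ^ 9 - 3 * e ^ 5 + 2 * e ^ 3) =
      of_nat 9 * (e ^ 9 - 3 * e ^ 5 + 2 * e ^ 3) + 12 * (e ^ 5 - e ^ 3)"
    unfolding deriv_e_power by (simp add: algebra_simps)
qed (simp add: edge_gf_0 e_power_nth numeral_fps_const)

text \<open>As for smaller \<open>n\<close>, the factor is \<open>n!\<close> and the right side is
  the cumulant formula \<open>m4 - 4 m3 m1 - 3 m2^2 + 12 m2 m1^2 - 6 m1^4\<close> at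
  \<open>mi = e ^ (i^2)\<close>.\<close>

lemma edge_gf_4:
  "24 * edge_gf 4 = e ^ 16 - 4 * e ^ 10 - 3 * e ^ 8 + 12 * e ^ 6 - 6 * e ^ 4" (is "_ = ?P")
proof (rule fps_linear_ODE_unique)
  have set: "{Suc 0..3} = {1, 2, 3}" by auto
  \<comment> \<open>This is 24 times the expanded inhomogeneity
    \<open>e * (e ^ 9 - 3 * e ^ 5 + 2 * e ^ 3) + (e ^ 4 - e ^ 2) ^ 2\<close>.\<close>
  let ?H = "24 * e ^ 10 + 24 * e ^ 8 - 120 * e ^ 6 + 72 * e ^ 4"
  have "2 * fps_deriv (edge_gf 4) =
      16 * edge_gf 4 + 6 * (edge_gf 1 * edge_gf 3) + 4 * edge_gf 2 ^ 2"
    using edge_gf_deriv[of 4] by (simp add: set algebra_simps power2_eq_square)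
  then have "2 * fps_deriv (edge_gf 4) =
      16 * edge_gf 4 + e * (e ^ 9 - 3 * e ^ 5 + 2 * e ^ 3) + (e ^ 4 - e ^ 2) ^ 2"
    unfolding edge_gf_1 using edge_gf_2 edge_gf_3 by algebra
  then show "2 * fps_deriv (24 * edge_gf 4) = of_nat 16 * (24 * edge_gf 4) + ?H"
    by (simp add: algebra_simps) algebra
  have "2 * fps_deriv ?P = 2 * fps_deriv (e ^ 16) - 4 * (2 * fps_deriv (e ^ 10)) -
      3 * (2 * fps_deriv (e ^ 8)) + 12 * (2 * fps_deriv (e ^ 6)) - 6 * (2 * fps_deriv (e ^ 4))"
    by (simp add: algebra_simps)
  then show "2 * fps_deriv ?P = of_nat 16 * ?P + ?H"
    unfolding deriv_e_power by (simp add: algebra_simps)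
qed (simp add: edge_gf_0 e_power_nth numeral_fps_const)

section \<open>Closed forms\<close>

text \<open>The factorial cancels the one in the exponential series: a summand
  \<open>c * e ^ r\<close> of \<open>edge_gf n\<close> contributes
  \<open>c * (r/2) ^ (n - 1) * r ^ k\<close> to \<open>J n k\<close>.\<close>

lemma J_eq_edge_gf_nth: "n \<ge> 1 \<Longrightarrow> J n k = 2 ^ k * fact (n + k - 1) * edge_gf n $ (n + k - 1)"
  by (simp add: J_def edge_gf_def)

lemma J_1: "J 1 k = 1"
  unfolding J_eq_edge_gf_nth[OF order_refl] edge_gf_1 by (simp add: power_divide)

text \<open>The integer exponent matters at \<open>k = 0\<close>, where the subtracted term is
  1/2.\<close>

lemma J_2: "J 2 k = 4 ^ k - 2 powi (int k - 1)"
proof -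
  have "2 * edge_gf 2 $ Suc k = (2 * edge_gf 2) $ Suc k"
    by (simp add: numeral_fps_const)
  then have "2 * J 2 k = 2 ^ k * (fact (Suc k) * (e ^ 4 - e ^ 2) $ Suc k)"
    by (simp add: J_eq_edge_gf_nth edge_gf_2 del: fact_Suc)
  also have "fact (Suc k) * (e ^ 4 - e ^ 2) $ Suc k = 2 ^ Suc k - 1"
    by (simp add: e_power_nth right_diff_distrib del: fact_Suc)
  also have "2 ^ k * (2 ^ Suc k - 1) = 2 * (4 ^ k - 2 powi (int k - 1) :: rat)"
    by (simp add: power_int_diff right_diff_distrib power_mult_distrib[symmetric])
  finally show ?thesis by simp
qed

lemma J_3: "J 3 k = - (25/8) * 5 ^ k + 3/4 * 3 ^ k + 27/8 * 9 ^ k"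
proof -
  have "6 * edge_gf 3 $ (k + 2) = (6 * edge_gf 3) $ (k + 2)"
    by (simp add: numeral_fps_const)
  then have "6 * J 3 k = 2 ^ k * (fact (k + 2) * (e ^ 9 - 3 * e ^ 5 + 2 * e ^ 3) $ (k + 2))"
    by (simp add: J_eq_edge_gf_nth edge_gf_3 add.commute del: fact_Suc)
  also have "fact (k + 2) * (e ^ 9 - 3 * e ^ 5 + 2 * e ^ 3) $ (k + 2) =
      (9/2) ^ (k + 2) - 3 * (5/2) ^ (k + 2) + 2 * (3/2) ^ (k + 2)"
    by (simp add: e_power_nth numeral_fps_const algebra_simps del: fact_Suc)
  also have "2 ^ k * \<dots> = 6 * (- (25/8) * 5 ^ k + 3/4 * 3 ^ k + 27/8 * 9 ^ k)"
    by (simp add: power_add power_divide field_simps)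
  finally show ?thesis by simp
qed

lemma J_4: "J 4 k = 64/3 * 16 ^ k + 27/2 * 6 ^ k - 250/12 * 10 ^ k - 2 * 4 ^ k - 8 * 8 ^ k"
proof -
  have "24 * edge_gf 4 $ (k + 3) = (24 * edge_gf 4) $ (k + 3)"
    by (simp add: numeral_fps_const)
  then have "24 * J 4 k = 2 ^ k * (fact (k + 3) *
      (e ^ 16 - 4 * e ^ 10 - 3 * e ^ 8 + 12 * e ^ 6 - 6 * e ^ 4) $ (k + 3))"
    by (simp add: J_eq_edge_gf_nth edge_gf_4 add.commute del: fact_Suc)
  also have "fact (k + 3) * (e ^ 16 - 4 * e ^ 10 - 3 * e ^ 8 + 12 * e ^ 6 - 6 * e ^ 4) $ (k + 3) =
      8 ^ (k + 3) - 4 * 5 ^ (k + 3) - 3 * 4 ^ (k + 3) + 12 * 3 ^ (k + 3) - 6 * 2 ^ (k + 3)"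
    by (simp add: e_power_nth numeral_fps_const algebra_simps del: fact_Suc)
  also have "2 ^ k * \<dots> =
      24 * (64/3 * 16 ^ k + 27/2 * 6 ^ k - 250/12 * 10 ^ k - 2 * 4 ^ k - 8 * 8 ^ k :: rat)"
  proof -
    \<comment> \<open>The cubes split off from the exponents \<open>k + 3\<close> are already in the
      constants, such as \<open>500 = 4 * 5 ^ 3\<close>; what remains is to absorb
      \<open>2 ^ k\<close> into each base.\<close>
    have "(2 :: rat) ^ k * (512 * 8 ^ k - 500 * 5 ^ k - 192 * 4 ^ k + 324 * 3 ^ k - 48 * 2 ^ k) =
        512 * (2 * 8) ^ k + 324 * (2 * 3) ^ k - 500 * (2 * 5) ^ k - 48 * (2 * 2) ^ k -
        192 * (2 * 4) ^ k"
      unfolding power_mult_distrib by algebra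
    then show ?thesis by (simp add: power_add mult.commute[of _ 512])
  qed
  finally show ?thesis by simp
qed

section \<open>Rational generating functions\<close>

lemma fps_eq_divideI:
  fixes A D N :: "'a :: field fps"
  assumes "A * D = N" "D $ 0 \<noteq> 0"
  shows "A = N / D"
proof -
  have "D \<noteq> 0" using assms(2) by auto
  then show ?thesis using assms(1) by (metis nonzero_mult_div_cancel_right)
qed

abbreviation geom :: "rat \<Rightarrow> rat fps" where "geom c \<equiv> Abs_fps (\<lambda>k. c ^ k)"

lemma geom_mult: "geom c * (1 - fps_const c * fps_X) = 1"
  by (rule fps_ext) (auto simp: right_diff_distrib mult.left_commute power_eq_if)

text \<open>Written with a numeral instead of \<open>fps_const\<close>, the relation matches the
  denominators below and can be used by \<open>algebra\<close>.\<close>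

lemma geom_numeral_mult: "geom (numeral c) * (1 - numeral c * fps_X) = 1"
  using geom_mult[of "numeral c"] by (simp add: numeral_fps_const)

lemma J_gf_1: "Abs_fps (J 1) = 1 / (1 - fps_X)"
proof (rule fps_eq_divideI)
  have "Abs_fps (J 1) = geom 1" by (rule fps_ext) (simp add: J_1[unfolded One_nat_def])
  then show "Abs_fps (J 1) * (1 - fps_X) = 1" using geom_mult[of 1] by simp
qed simp

lemma J_gf_2: "Abs_fps (J 2) = fps_const (1/2) / ((1 - 2 * fps_X) * (1 - 4 * fps_X))"
proof (rule fps_eq_divideI)
  let ?D = "(1 - 2 * fps_X) * (1 - 4 * fps_X) :: rat fps"
  \<comment> \<open>This is the partial fraction decomposition, scaled to integer coefficients so
    that \<open>algebra\<close> needs no division.\<close>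
  have "2 * Abs_fps (J 2) = 2 * geom 4 - geom 2"
    by (rule fps_ext) (simp add: J_2 numeral_fps_const power_int_diff)
  \<comment> \<open>The two \<open>Num\<close> terms encode 4 and 2.\<close>
  then have "2 * (Abs_fps (J 2) * ?D) = 1"
    using geom_numeral_mult[of "Num.Bit0 (Num.Bit0 Num.One)"]
      geom_numeral_mult[of "Num.Bit0 Num.One"] by algebra
  also have "1 = 2 * (fps_const (1/2) :: rat fps)"
    by (simp add: numeral_fps_const)
  finally show "Abs_fps (J 2) * ?D = fps_const (1/2)" by simp
qed simp

lemma J_gf_3: "Abs_fps (J 3) = 1 / ((1 - 3 * fps_X) * (1 - 5 * fps_X) * (1 - 9 * fps_X))"
proof (rule fps_eq_divideI)
  let ?D = "(1 - 3 * fps_X) * (1 - 5 * fps_X) * (1 - 9 * fps_X) :: rat fps"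
  have geoms: "geom 3 * (1 - 3 * fps_X) = 1" "geom 5 * (1 - 5 * fps_X) = 1"
      "geom 9 * (1 - 9 * fps_X) = 1"
    by (rule geom_numeral_mult)+
  have "8 * Abs_fps (J 3) = 27 * geom 9 - 25 * geom 5 + 6 * geom 3"
    by (rule fps_ext) (simp add: J_3 numeral_fps_const)
  then have "8 * (Abs_fps (J 3) * ?D) = 8 * 1"
    using geoms by algebra
  then show "Abs_fps (J 3) * ?D = 1" by simp
qed simp

lemma J_gf_4: "Abs_fps (J 4) = (4 - 34 * fps_X) /
  ((1 - 4 * fps_X) * (1 - 6 * fps_X) * (1 - 8 * fps_X) * (1 - 10 * fps_X) * (1 - 16 * fps_X))"
proof (rule fps_eq_divideI)
  let ?D = "(1 - 4 * fps_X) * (1 - 6 * fps_X) * (1 - 8 * fps_X) * (1 - 10 * fps_X) *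
    (1 - 16 * fps_X) :: rat fps"
  have geoms: "geom 4 * (1 - 4 * fps_X) = 1" "geom 6 * (1 - 6 * fps_X) = 1"
      "geom 8 * (1 - 8 * fps_X) = 1" "geom 10 * (1 - 10 * fps_X) = 1"
      "geom 16 * (1 - 16 * fps_X) = 1"
    by (rule geom_numeral_mult)+
  have "6 * Abs_fps (J 4) =
      128 * geom 16 + 81 * geom 6 - 125 * geom 10 - 12 * geom 4 - 48 * geom 8"
    by (rule fps_ext) (simp add: J_4 numeral_fps_const)
  then have "6 * (Abs_fps (J 4) * ?D) = 6 * (4 - 34 * fps_X)"
    using geoms by algebra
  then show "Abs_fps (J 4) * ?D = 4 - 34 * fps_X"
    by (subst (asm) mult_cancel_left) simp
qed simp

theorem theorem4:
  shows
    "(\<forall>k. J 1 k = 1) \<and>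
     Abs_fps (J 1) = 1 / (1 - fps_X) \<and>
     (\<forall>k. J 2 k = 4 ^ k - 2 powi (int k - 1)) \<and>
     Abs_fps (J 2) = fps_const (1/2) / ((1 - 2 * fps_X) * (1 - 4 * fps_X)) \<and>
     (\<forall>k. J 3 k = - (25/8) * 5 ^ k + 3/4 * 3 ^ k + 27/8 * 9 ^ k) \<and>
     Abs_fps (J 3) = 1 / ((1 - 3 * fps_X) * (1 - 5 * fps_X) * (1 - 9 * fps_X)) \<and>
     (\<forall>k. J 4 k = 64/3 * 16 ^ k + 27/2 * 6 ^ k - 250/12 * 10 ^ k - 2 * 4 ^ k - 8 * 8 ^ k) \<and>
     Abs_fps (J 4) = (4 - 34 * fps_X) /
       ((1 - 4 * fps_X) * (1 - 6 * fps_X) * (1 - 8 * fps_X) * (1 - 10 * fps_X) * (1 - 16 * fps_X))"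
  by (intro conjI allI J_1 J_2 J_3 J_4 J_gf_1 J_gf_2 J_gf_3 J_gf_4)

end
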